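(* Let $a,b,s>0$ and let $\beta_{a,b}$ be a Beta random variable with parameters $a,b$. Then the random variable $\beta_{a,b}^{-s}-1$ belongs to $\mathcal{M}$ (that is, it has a completely monotone density on $(0,+\infty)$) if and only if $b\le 1$.
   Context: For $a,b>0$, $\beta_{a,b}$ denotes a random variable with density $\frac{\Gamma(a+b)}{\Gamma(a)\Gamma(b)}x^{a-1}(1-x)^{b-1}\mathbf{1}_{(0,1)}(x)$. $\mathcal{M}$ is the class of positive random variables having a completely monotone density on $(0,+\infty)$. A function $f:(0,+\infty)\to[0,+\infty)$ is completely monotone if it is $C^\infty$ and $(-1)^n f^{(n)}\ge 0$ on $(0,+\infty)$ for all integers $n\ge 0$. *)

theory Defs
  imports "HOL-Probability.Probability"
begin

definition beta_density :: "real \<Rightarrow> real \<Rightarrow> real \<Rightarrow> real" where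
  "beta_density a b x =
     Gamma (a + b) / (Gamma a * Gamma b) * x powr (a - 1) * (1 - x) powr (b - 1)
       * indicator {0<..<1} x"

(* Since the half-line {0<..} is open, the iterated derivatives at points of it depend only on
   the values of f there; the values of f at x \<le> 0 are irrelevant. *)
definition completely_monotone :: "(real \<Rightarrow> real) \<Rightarrow> bool" where
  "completely_monotone f \<longleftrightarrow>
     (\<forall>n. (deriv ^^ n) f differentiable_on {0<..} \<and>
          (\<forall>x>0. 0 \<le> (- 1) ^ n * (deriv ^^ n) f x))"

definition has_cm_density :: "'a measure \<Rightarrow> ('a \<Rightarrow> real) \<Rightarrow> bool" where
  "has_cm_density M Y \<longleftrightarrow>
     (\<exists>f. completely_monotone f \<and>
          distributed M lborel Y (\<lambda>x. ennreal (f x * indicator {0<..} x)))"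

(* Positivity is required almost surely only, as random variables given through their law are
   determined only up to null sets. *)
definition in_class_M :: "'a measure \<Rightarrow> ('a \<Rightarrow> real) \<Rightarrow> bool" where
  "in_class_M M Y \<longleftrightarrow> (AE \<omega> in M. 0 < Y \<omega>) \<and> has_cm_density M Y"

end

theory Submission
  imports Defs
begin

text \<open>
  With \<open>t = 1 / s\<close>, the variable \<open>\<beta>\<^sub>a\<^sub>,\<^sub>b powr (-s) - 1\<close> has density proportional to
  \<open>(1 + y) powr (-ta - 1) * h y powr (b - 1)\<close> on the half-line, where \<open>h y = 1 - (1 + y) powr (-t)\<close>.
  If \<open>b \<le> 1\<close>, this is a product \<open>(1 + y) powr (-p) * h y powr (-q)\<close> with \<open>p, q \<ge> 0\<close>. The negative
  derivative of such a product is a nonnegative combination of two products of the same shape, so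
  that complete monotonicity follows by iteration. If \<open>b > 1\<close>, the density is positive but tends to
  0 at 0, so it does not agree almost everywhere with a decreasing function.
\<close>

section \<open>Complete monotonicity on the half-line\<close>

text \<open>By induction, \<open>(deriv ^^ n) f\<close> agrees on the half-line with
  \<open>(- 1) ^ n * g\<close> for some \<open>g\<close> in \<open>S\<close>. The sign and the
  differentiability of every derivative are then inherited from \<open>S\<close>.\<close>

lemma completely_monotone_of_closed:
  assumes nonneg: "\<And>f x. f \<in> S \<Longrightarrow> x > 0 \<Longrightarrow> 0 \<le> f x"
    and deriv: "\<And>f. f \<in> S \<Longrightarrow> \<exists>g\<in>S. \<forall>x>0. (f has_real_derivative - g x) (at x)"
    and "f \<in> S"
  shows "completely_monotone f"
proof -
  have repr: "\<exists>g\<in>S. \<forall>x>0. (deriv ^^ n) f x = (- 1) ^ n * g x" for n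
  proof (induction n)
    case 0
    then show ?case using \<open>f \<in> S\<close> by auto
  next
    case (Suc n)
    then obtain g where g: "g \<in> S" "\<And>x. x > 0 \<Longrightarrow> (deriv ^^ n) f x = (- 1) ^ n * g x" by blast
    from deriv[OF g(1)] obtain k
      where k: "k \<in> S" "\<And>x. x > 0 \<Longrightarrow> (g has_real_derivative - k x) (at x)" by blast
    have "(deriv ^^ Suc n) f x = (- 1) ^ Suc n * k x" if "x > 0" for x
    proof -
      have "((\<lambda>x. (- 1) ^ n * g x) has_real_derivative (- 1) ^ n * - k x) (at x)"
        by (intro DERIV_cmult k that)
      then have "((deriv ^^ n) f has_real_derivative (- 1) ^ n * - k x) (at x)"
        by (rule has_field_derivative_transform_within_open[where S = "{0<..}"])
           (use g that in auto)
      then show ?thesis by (simp add: DERIV_imp_deriv)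
    qed
    with k show ?case by blast
  qed
  show ?thesis
    unfolding completely_monotone_def
  proof (intro allI conjI impI)
    fix n
    obtain g where g: "g \<in> S" "\<And>x. x > 0 \<Longrightarrow> (deriv ^^ n) f x = (- 1) ^ n * g x"
      using repr by blast
    from deriv[OF g(1)] obtain k
      where k: "\<And>x. x > 0 \<Longrightarrow> (g has_real_derivative - k x) (at x)" by blast
    show "(deriv ^^ n) f differentiable_on {0<..}"
      unfolding differentiable_on_def
    proof
      fix x :: real assume x: "x \<in> {0<..}"
      have "((\<lambda>x. (- 1) ^ n * g x) has_real_derivative (- 1) ^ n * - k x) (at x)"
        using x by (intro DERIV_cmult k) simp
      then have "((deriv ^^ n) f has_real_derivative (- 1) ^ n * - k x) (at x)"
        by (rule has_field_derivative_transform_within_open[where S = "{0<..}"])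
           (use g x in auto)
      then show "(deriv ^^ n) f differentiable at x within {0<..}"
        by (meson differentiable_at_withinI real_differentiable_def)
    qed
    fix x :: real assume "x > 0"
    then show "0 \<le> (- 1) ^ n * (deriv ^^ n) f x"
      using g nonneg[OF g(1)] by (simp flip: power_mult_distrib mult.assoc)
  qed
qed

lemma completely_monotone_antimono:
  assumes "completely_monotone f" "0 < x" "x \<le> y"
  shows "f y \<le> f x"
proof (rule DERIV_nonpos_imp_nonincreasing[OF \<open>x \<le> y\<close>])
  fix z assume "x \<le> z" "z \<le> y"
  with \<open>0 < x\<close> have z: "z > 0" by simp
  have "f differentiable_on {0<..}" "deriv f z \<le> 0"
    using assms(1)[unfolded completely_monotone_def, rule_format, of 0]
      assms(1)[unfolded completely_monotone_def, rule_format, of 1] z by auto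
  then have "f differentiable at z"
    using z by (simp add: differentiable_on_eq_differentiable_at)
  then have "(f has_real_derivative deriv f z) (at z)"
    by (simp add: DERIV_deriv_iff_real_differentiable)
  with \<open>deriv f z \<le> 0\<close> show "\<exists>d. (f has_real_derivative d) (at z) \<and> d \<le> 0" by blast
qed

section \<open>A cone closed under negative differentiation\<close>

text \<open>Differentiating one product yields two, hence the closure under sums. The exponents vary
  under differentiation while \<open>t\<close> stays fixed.\<close>

inductive_set powr_cone :: "real \<Rightarrow> (real \<Rightarrow> real) set" for t :: real where
  prod: "0 \<le> c \<Longrightarrow> 0 \<le> p \<Longrightarrow> 0 \<le> q \<Longrightarrow>
    (\<lambda>y. c * (1 + y) powr (- p) * (1 - (1 + y) powr (- t)) powr (- q)) \<in> powr_cone t"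
| add: "f \<in> powr_cone t \<Longrightarrow> g \<in> powr_cone t \<Longrightarrow> (\<lambda>y. f y + g y) \<in> powr_cone t"

lemma one_minus_powr_pos:
  fixes t y :: real
  assumes "t > 0" "y > 0"
  shows "1 - (1 + y) powr (- t) > 0"
  using assms powr_less_mono[of "- t" 0 "1 + y"] by simp

lemma powr_cone_nonneg: "f \<in> powr_cone t \<Longrightarrow> 0 \<le> f x"
  by (induction rule: powr_cone.induct) auto

text \<open>The base \<open>1 - (1 + y) powr (- t)\<close> has derivative
  \<open>t * (1 + y) powr (- t - 1)\<close>. The product rule therefore sends \<open>(p, q)\<close>
  to \<open>(p + 1, q)\<close> and \<open>(p + t + 1, q + 1)\<close>, with negated coefficients
  \<open>c * p\<close> and \<open>c * q * t\<close>, both nonnegative.\<close>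

lemma powr_cone_deriv:
  assumes "t > 0" "f \<in> powr_cone t"
  shows "\<exists>g\<in>powr_cone t. \<forall>x>0. (f has_real_derivative - g x) (at x)"
  using assms(2)
proof induction
  case (prod c p q)
  let ?g = "\<lambda>y. (c * p) * (1 + y) powr (- (p + 1)) * (1 - (1 + y) powr (- t)) powr (- q)
    + (c * q * t) * (1 + y) powr (- (p + t + 1)) * (1 - (1 + y) powr (- t)) powr (- (q + 1))"
  have "?g \<in> powr_cone t"
    using prod \<open>t > 0\<close> by (intro powr_cone.intros) auto
  moreover have "((\<lambda>y. c * (1 + y) powr (- p) * (1 - (1 + y) powr (- t)) powr (- q))
      has_real_derivative - ?g x) (at x)" if x: "x > 0" for x
  proof -
    let ?h = "1 - (1 + x) powr (- t)"
    have h: "?h > 0" using one_minus_powr_pos[OF \<open>t > 0\<close> x] .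
    have *: "((\<lambda>y. (1 + y) powr (- r)) has_real_derivative - r * (1 + x) powr (- r - 1)) (at x)"
      for r
      by (rule DERIV_cong[OF DERIV_fun_powr[where r = "- r" and m = 1]])
         (use x in \<open>auto intro!: derivative_eq_intros\<close>)
    have **: "((\<lambda>y. (1 - (1 + y) powr (- t)) powr (- q)) has_real_derivative
        (- q) * ?h powr (- q - 1) * (t * (1 + x) powr (- t - 1))) (at x)"
      by (rule DERIV_cong[OF DERIV_fun_powr[where r = "- q"
            and m = "t * (1 + x) powr (- t - 1)"]])
         (use h x in \<open>auto intro!: derivative_eq_intros *\<close>)
    have ***: "(1 + x) powr (- (p + t + 1)) = (1 + x) powr (- t - 1) * (1 + x) powr (- p)"
      unfolding powr_add[symmetric] by (rule arg_cong[where f = "(powr) (1 + x)"]) simp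
    have minus_diff: "- r - 1 = - (r + 1)" for r :: real by simp
    \<comment> \<open>With the powers replaced by free variables, only a polynomial identity is
      left.\<close>
    have ring: "c * (- p * P1) * H + (- q * H1 * (t * T1)) * (c * P)
        = - (c * p * P1 * H + c * q * t * (T1 * P) * H1)" for P1 H H1 T1 P :: real
      by (simp add: algebra_simps)
    show ?thesis
      by (rule DERIV_cong[OF DERIV_mult[OF DERIV_cmult[OF *, where c = c] **]])
         (unfold *** minus_diff, rule ring)
  qed
  ultimately show ?case by (intro bexI[of _ ?g]) simp_all
next
  case (add f g)
  then obtain f' g' where "f' \<in> powr_cone t" "g' \<in> powr_cone t"
    and d: "\<And>x. x > 0 \<Longrightarrow> (f has_real_derivative - f' x) (at x)"
      "\<And>x. x > 0 \<Longrightarrow> (g has_real_derivative - g' x) (at x)" by blast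
  then have "(\<lambda>y. f' y + g' y) \<in> powr_cone t" by (intro powr_cone.add)
  moreover have "((\<lambda>y. f y + g y) has_real_derivative - (f' x + g' x)) (at x)" if "x > 0" for x
    using DERIV_add[OF d(1)[OF that] d(2)[OF that]] by simp
  ultimately show ?case by (intro bexI[of _ "\<lambda>y. f' y + g' y"]) auto
qed

section \<open>The transformed density and its behaviour at 0\<close>

text \<open>For \<open>y > 0\<close> this is the beta density at
  \<open>u = (1 + y) powr (- t)\<close> times \<open>t * (1 + y) powr (- t - 1)\<close>, the
  absolute value of \<open>du/dy\<close>. In the application \<open>t = 1 / s\<close>.\<close>

definition beta_powr_density :: "real \<Rightarrow> real \<Rightarrow> real \<Rightarrow> real \<Rightarrow> real" where
  "beta_powr_density a b t y =
     Gamma (a + b) / (Gamma a * Gamma b) * t * (1 + y) powr (- (t * a + 1))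
       * (1 - (1 + y) powr (- t)) powr (b - 1)"

lemma completely_monotone_beta_powr_density:
  assumes "a > 0" "b > 0" "t > 0" "b \<le> 1"
  shows "completely_monotone (beta_powr_density a b t)"
proof (rule completely_monotone_of_closed[where S = "powr_cone t"])
  \<comment> \<open>A generator of the cone with \<open>p = t * a + 1\<close> and
    \<open>q = 1 - b\<close>; the bound \<open>b \<le> 1\<close> is what makes \<open>q\<close>
    nonnegative.\<close>
  have "(\<lambda>y. (Gamma (a + b) / (Gamma a * Gamma b) * t) * (1 + y) powr (- (t * a + 1))
      * (1 - (1 + y) powr (- t)) powr (- (1 - b))) \<in> powr_cone t"
    using assms by (intro powr_cone.prod)
      (auto intro!: mult_nonneg_nonneg divide_nonneg_nonneg less_imp_le Gamma_real_pos)
  then show "beta_powr_density a b t \<in> powr_cone t"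
    by (simp add: beta_powr_density_def[abs_def])
qed (use assms in \<open>auto intro: powr_cone_nonneg powr_cone_deriv\<close>)

lemma beta_powr_density_pos:
  assumes "a > 0" "b > 0" "t > 0" "y > 0"
  shows "beta_powr_density a b t y > 0"
  unfolding beta_powr_density_def
  using assms one_minus_powr_pos[of t y]
  by (intro mult_pos_pos divide_pos_pos Gamma_real_pos) auto

lemma beta_powr_density_tendsto_0:
  assumes "t > 0" "b > 1"
  shows "(beta_powr_density a b t \<longlongrightarrow> 0) (at_right 0)"
proof -
  have "((\<lambda>y::real. (1 + y) powr (- r)) \<longlongrightarrow> (1 + 0) powr (- r)) (at_right 0)" for r
    by (intro tendsto_powr tendsto_add tendsto_const tendsto_ident_at) auto
  then have powr_lim: "((\<lambda>y::real. (1 + y) powr (- r)) \<longlongrightarrow> 1) (at_right 0)" for r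
    by simp
  have "((\<lambda>y::real. 1 - (1 + y) powr (- t)) \<longlongrightarrow> 0) (at_right 0)"
    using tendsto_diff[OF tendsto_const powr_lim, of 1 t] by simp
  \<comment> \<open>The base tends to 0, where continuity of \<open>powr\<close> with a positive
    exponent requires approach through nonnegative values.\<close>
  moreover have "\<forall>\<^sub>F y::real in at_right 0. 0 \<le> 1 - (1 + y) powr (- t)"
    using eventually_at_right_less[of "0::real"]
    by eventually_elim (use one_minus_powr_pos[OF \<open>t > 0\<close>] in \<open>auto intro: less_imp_le\<close>)
  ultimately have "((\<lambda>y::real. (1 - (1 + y) powr (- t)) powr (b - 1)) \<longlongrightarrow> 0 powr (b - 1)) (at_right 0)"
    using \<open>b > 1\<close> by (intro tendsto_powr'[OF _ tendsto_const]) auto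
  then have "((\<lambda>y. Gamma (a + b) / (Gamma a * Gamma b) * t * (1 + y) powr (- (t * a + 1))
      * (1 - (1 + y) powr (- t)) powr (b - 1)) \<longlongrightarrow>
      Gamma (a + b) / (Gamma a * Gamma b) * t * 1 * 0 powr (b - 1)) (at_right 0)"
    by (intro tendsto_mult tendsto_const powr_lim)
  then show ?thesis by (simp add: beta_powr_density_def[abs_def])
qed

section \<open>The law of the transformed variable\<close>

context
  fixes M :: "'a measure" and X :: "'a \<Rightarrow> real" and a b s :: real
  assumes prob: "prob_space M" and pos: "a > 0" "b > 0" "s > 0"
    and dist: "distributed M lborel X (\<lambda>x. ennreal (beta_density a b x))"
begin

lemma beta_measurable: "X \<in> borel_measurable M"
  using distributed_measurable[OF dist] by simp

lemma AE_beta_unit_interval: "AE \<omega> in M. 0 < X \<omega> \<and> X \<omega> < 1"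
  by (subst prob_space.distributed_AE2[OF prob dist, of "\<lambda>x. 0 < x \<and> x < 1"], measurable,
      intro AE_I2) (auto simp: beta_density_def indicator_def)

lemma beta_powr_pos: "AE \<omega> in M. 0 < X \<omega> powr (- s) - 1"
  using AE_beta_unit_interval
  by eventually_elim (use pos powr_less_mono2_neg[of "- s" _ 1] in simp)

text \<open>The substitution \<open>x = (1 + y) powr (- (1 / s))\<close> reverses order and sends 0
  to 1. The right-hand side is the beta mass of an interval, from which the distribution function is
  read off.\<close>

lemma nn_integral_beta_powr_density:
  assumes "y \<ge> 0"
  shows "(\<integral>\<^sup>+x. ennreal (beta_powr_density a b (1 / s) x * indicator {0<..} x * indicator {..y} x) \<partial>lborel)
    = (\<integral>\<^sup>+x. ennreal (beta_density a b x) * indicator {(1 + y) powr (- (1 / s))..1} x \<partial>lborel)"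
proof -
  let ?t = "1 / s"
  \<comment> \<open>The reflection \<open>w = - y\<close> makes the substitution increasing.\<close>
  let ?u = "\<lambda>w::real. (1 - w) powr (- ?t)"
  let ?u' = "\<lambda>w::real. ?t * (1 - w) powr (- ?t - 1)"
  have t: "?t > 0" using pos by simp
  have [measurable]: "beta_powr_density a b ?t \<in> borel_measurable borel"
    unfolding beta_powr_density_def[abs_def] by measurable
  have [measurable]: "beta_density a b \<in> borel_measurable borel"
    unfolding beta_density_def[abs_def] by measurable
  have "(\<integral>\<^sup>+x. ennreal (beta_powr_density a b ?t x * indicator {0<..} x * indicator {..y} x) \<partial>lborel)
    = (\<integral>\<^sup>+w. ennreal (beta_powr_density a b ?t (- w) * indicator {0<..} (- w) * indicator {..y} (- w)) \<partial>lborel)"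
    by (subst nn_integral_real_affine[where c = "-1" and t = 0]) auto
  also have "\<dots> = (\<integral>\<^sup>+w. ennreal (beta_density a b (?u w) * ?u' w * indicator {- y..0} w) \<partial>lborel)"
  proof (intro nn_integral_cong)
    fix w :: real
    \<comment> \<open>At \<open>w = 0\<close> the left side vanishes through the indicator of
      \<open>{0<..}\<close>, the right side because \<open>?u 0 = 1\<close> lies outside the open
      unit interval.\<close>
    consider "w < - y \<or> w > 0" | "w = 0" | "- y \<le> w" "w < 0" by linarith
    then show "ennreal (beta_powr_density a b ?t (- w) * indicator {0<..} (- w) * indicator {..y} (- w))
      = ennreal (beta_density a b (?u w) * ?u' w * indicator {- y..0} w)"
    proof cases
      case 3
      have "?u w < 1" using one_minus_powr_pos[OF t, of "- w"] 3 by simp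
      \<comment> \<open>The exponents match:
        \<open>- t * (a - 1) - t - 1 = - (t * a + 1)\<close>.\<close>
      moreover have "(1 - w) powr (- (?t * a + 1)) = ?u w powr (a - 1) * (1 - w) powr (- ?t - 1)"
        using 3 by (simp add: powr_powr powr_add[symmetric] algebra_simps diff_divide_distrib)
      ultimately have "beta_powr_density a b ?t (- w) = beta_density a b (?u w) * ?u' w"
        using 3 by (simp add: beta_powr_density_def beta_density_def)
      then show ?thesis using 3 by simp
    qed (use assms in \<open>auto simp: beta_density_def\<close>)
  qed
  also have "\<dots> = (\<integral>\<^sup>+x. ennreal (beta_density a b x * indicator {?u (- y)..?u 0} x) \<partial>lborel)"
  proof (rule nn_integral_substitution[symmetric])
    show "set_borel_measurable borel {?u (- y)..?u 0} (beta_density a b)"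
      unfolding set_borel_measurable_def by measurable
    fix w assume w: "w \<in> {- y..0}"
    show "(?u has_real_derivative ?u' w) (at w)"
      by (rule DERIV_cong[OF DERIV_fun_powr[where r = "- ?t" and m = "- 1"]])
         (use w in \<open>auto intro!: derivative_eq_intros\<close>)
    show "0 \<le> ?u' w" using t by simp
  next
    show "continuous_on {- y..0} ?u'"
      by (intro continuous_intros) auto
  qed (use assms in auto)
  also have "\<dots> = (\<integral>\<^sup>+x. ennreal (beta_density a b x) * indicator {(1 + y) powr (- ?t)..1} x \<partial>lborel)"
    by (intro nn_integral_cong) (auto simp: indicator_def)
  finally show ?thesis .
qed

text \<open>The density is identified through the distribution function: the event that the variable
  is at most \<open>y\<close> is, for \<open>y \<ge> 0\<close>, almost surely a lower bound on
  \<open>X\<close>.\<close>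

lemma distributed_beta_powr:
  "distributed M lborel (\<lambda>\<omega>. X \<omega> powr (- s) - 1)
     (\<lambda>y. ennreal (beta_powr_density a b (1 / s) y * indicator {0<..} y))"
proof (rule distributedI_borel_atMost[where g = "\<lambda>y. measure M {\<omega>\<in>space M. X \<omega> powr (- s) - 1 \<le> y}"])
  interpret prob_space M by (rule prob)
  have [measurable]: "X \<in> borel_measurable M" by (rule beta_measurable)
  show "(\<lambda>\<omega>. X \<omega> powr (- s) - 1) \<in> borel_measurable M" by measurable
  show "(\<lambda>y. beta_powr_density a b (1 / s) y * indicator {0<..} y) \<in> borel_measurable borel"
    unfolding beta_powr_density_def[abs_def] by measurable
  show "AE y in lborel. 0 \<le> beta_powr_density a b (1 / s) y * indicator {0<..} y"
    using beta_powr_density_pos[of a b "1 / s"] pos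
    by (intro AE_I2) (auto simp: indicator_def intro: less_imp_le)
  show emeasure_eq: "emeasure M {\<omega>\<in>space M. X \<omega> powr (- s) - 1 \<le> y}
      = ennreal (measure M {\<omega>\<in>space M. X \<omega> powr (- s) - 1 \<le> y})" for y
    by (rule emeasure_eq_measure)
  fix y :: real
  show "(\<integral>\<^sup>+x. ennreal (beta_powr_density a b (1 / s) x * indicator {0<..} x * indicator {..y} x) \<partial>lborel)
      = ennreal (measure M {\<omega>\<in>space M. X \<omega> powr (- s) - 1 \<le> y})"
  proof (cases "y \<ge> 0")
    case True
    \<comment> \<open>The map \<open>x powr (- s)\<close> is decreasing and takes
      \<open>(1 + y) powr (- (1 / s))\<close> to \<open>1 + y\<close>.\<close>
    have *: "x powr (- s) - 1 \<le> y \<longleftrightarrow> (1 + y) powr (- (1 / s)) \<le> x" if "x > 0" for x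
    proof -
      have "x powr (- s) - 1 \<le> y \<longleftrightarrow> x powr (- s) \<le> ((1 + y) powr (- (1 / s))) powr (- s)"
        using True pos by (auto simp: powr_powr)
      also have "\<dots> \<longleftrightarrow> (1 + y) powr (- (1 / s)) \<le> x"
        using powr_less_mono2_neg[of "- s" x "(1 + y) powr (- (1 / s))"]
          powr_mono2'[of "- s" "(1 + y) powr (- (1 / s))" x] pos that True by fastforce
      finally show ?thesis .
    qed
    have "(\<integral>\<^sup>+x. ennreal (beta_powr_density a b (1 / s) x * indicator {0<..} x * indicator {..y} x) \<partial>lborel)
      = emeasure M (X -` {(1 + y) powr (- (1 / s))..1} \<inter> space M)"
      using nn_integral_beta_powr_density[OF True]
        distributed_emeasure[OF dist, of "{(1 + y) powr (- (1 / s))..1}"] by simp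
    \<comment> \<open>The upper endpoint 1 costs nothing, since \<open>X\<close> lies in the open
      unit interval almost surely.\<close>
    also have "\<dots> = emeasure M {\<omega>\<in>space M. X \<omega> powr (- s) - 1 \<le> y}"
      by (intro emeasure_eq_AE) (use AE_beta_unit_interval * in auto)
    finally show ?thesis by (simp add: emeasure_eq)
  next
    case False
    have "AE \<omega> in M. \<not> X \<omega> powr (- s) - 1 \<le> y"
      using beta_powr_pos by eventually_elim (use False in simp)
    then have "measure M {\<omega>\<in>space M. X \<omega> powr (- s) - 1 \<le> y} = 0"
      by (subst prob_eq_0) auto
    moreover have "(\<integral>\<^sup>+x. ennreal (beta_powr_density a b (1 / s) x * indicator {0<..} x
        * indicator {..y} x) \<partial>lborel) = (\<integral>\<^sup>+x. 0 \<partial>(lborel :: real measure))"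
      by (intro nn_integral_cong) (use False in \<open>auto simp: indicator_def\<close>)
    ultimately show ?thesis by simp
  qed
qed

end

section \<open>Comparison of densities and the equivalence\<close>

text \<open>A nonempty open interval has positive length and so cannot lie in the exceptional null
  set. This supplies actual points at which two almost everywhere equal densities agree.\<close>

lemma AE_lborel_imp_ex_between:
  fixes c d :: real
  assumes "AE x in lborel. P x" "c < d"
  shows "\<exists>x. c < x \<and> x < d \<and> P x"
proof (rule ccontr)
  assume "\<not> ?thesis"
  with assms(1) have "AE x in lborel. x \<notin> {c<..<d}" by (auto elim!: eventually_mono)
  then have "emeasure lborel {c<..<d} = 0"
    by (subst (asm) AE_iff_measurable[where N = "{c<..<d}"]) auto
  with \<open>c < d\<close> show False by simp
qed

theorem theorem1:
  fixes M :: "'a measure" and X :: "'a \<Rightarrow> real" and a b s :: real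
  assumes "prob_space M"
    and "a > 0" and "b > 0" and "s > 0"
    and "distributed M lborel X (\<lambda>x. ennreal (beta_density a b x))"
  shows "in_class_M M (\<lambda>\<omega>. X \<omega> powr (- s) - 1) \<longleftrightarrow> b \<le> 1"
proof
  assume "b \<le> 1"
  then show "in_class_M M (\<lambda>\<omega>. X \<omega> powr (- s) - 1)"
    unfolding in_class_M_def has_cm_density_def
    using beta_powr_pos[OF assms] distributed_beta_powr[OF assms]
      completely_monotone_beta_powr_density[of a b "1 / s"] assms by auto
next
  let ?g = "beta_powr_density a b (1 / s)"
  assume "in_class_M M (\<lambda>\<omega>. X \<omega> powr (- s) - 1)"
  then obtain f where f: "completely_monotone f"
    "distributed M lborel (\<lambda>\<omega>. X \<omega> powr (- s) - 1) (\<lambda>x. ennreal (f x * indicator {0<..} x))"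
    unfolding in_class_M_def has_cm_density_def by blast
  have g_pos: "?g x > 0" if "x > 0" for x
    using beta_powr_density_pos[of a b "1 / s"] assms that by simp
  have f_nonneg: "f x \<ge> 0" if "x > 0" for x
    using f(1)[unfolded completely_monotone_def, rule_format, of 0] that by simp
  have "AE x in lborel. ennreal (f x * indicator {0<..} x) = ennreal (?g x * indicator {0<..} x)"
    by (rule prob_space.distributed_unique[OF assms(1) f(2) distributed_beta_powr[OF assms]])
  \<comment> \<open>Both densities are nonnegative on the half-line, so \<open>ennreal\<close> can
    be removed.\<close>
  then have AE_eq: "AE x in lborel. x > 0 \<longrightarrow> f x = ?g x"
    by eventually_elim (use f_nonneg g_pos in \<open>auto simp: less_imp_le\<close>)
  show "b \<le> 1"
  proof (rule ccontr)
    assume "\<not> b \<le> 1"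
    then have lim: "(?g \<longlongrightarrow> 0) (at_right 0)"
      using assms by (intro beta_powr_density_tendsto_0) auto
    obtain y where y: "y > 0" "f y = ?g y"
      using AE_lborel_imp_ex_between[OF AE_eq, of 0 1] by auto
    \<comment> \<open>The positive value \<open>?g y\<close> serves as threshold for the limit 0. A
      point of agreement \<open>x\<close> below both \<open>d\<close> and \<open>y\<close> then
      gives \<open>f x < f y\<close>, although \<open>f\<close> is decreasing.\<close>
    obtain d where d: "d > 0" "\<And>x. 0 < x \<Longrightarrow> x < d \<Longrightarrow> ?g x < ?g y"
      using order_tendstoD(2)[OF lim g_pos[OF y(1)]] by (auto simp: eventually_at_right_field)
    obtain x where x: "0 < x" "x < min d y" "f x = ?g x"
      using AE_lborel_imp_ex_between[OF AE_eq, of 0 "min d y"] d y by auto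
    with completely_monotone_antimono[OF f(1), of x y] d(2)[of x] y show False by simp
  qed
qed

end
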